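(* There is no distance-regular graph with intersection array $\{234,165,12;1,30,198\}$.
   Context: A connected graph $\Gamma$ of diameter $d$ is distance-regular if there are constants $p^h_{ij}$ ($0\le h,i,j\le d$) such that for any two vertices $u,v$ at distance $h$, the number of vertices at distance $i$ from $u$ and distance $j$ from $v$ is $p^h_{ij}$. Its intersection array is $\{b_0,b_1,\dots,b_{d-1};c_1,c_2,\dots,c_d\}$ where $b_i=p^i_{1,i+1}$ and $c_{i+1}=p^{i+1}_{1,i}$. *)

theory Defs
  imports "Graph_Theory.Digraph_Component"
begin

text \<open>
  Finite simple undirected graphs are the \<^locale>\<open>pair_graph\<close>s: a finite vertex set with a
  symmetric, loop-free set of ordered pairs as arcs. The vertex set of a \<^const>\<open>connected\<close>
  graph is nonempty.
\<close>

definition graph_dist :: "'a pair_pre_digraph \<Rightarrow> 'a \<Rightarrow> 'a \<Rightarrow> nat" where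
  "graph_dist G u v = (LEAST n. \<exists>p. pre_digraph.awalk (with_proj G) u p v \<and> length p = n)"

definition graph_diameter :: "'a pair_pre_digraph \<Rightarrow> nat" where
  "graph_diameter G = Max {graph_dist G u v | u v. u \<in> pverts G \<and> v \<in> pverts G}"

text \<open>
  \<open>p h i j\<close> stands for $p^h_{ij}$. Only its values for \<open>h, i, j\<close> up to the diameter are
  constrained, and these are determined by the graph.
\<close>

definition intersection_numbers :: "'a pair_pre_digraph \<Rightarrow> (nat \<Rightarrow> nat \<Rightarrow> nat \<Rightarrow> nat) \<Rightarrow> bool" where
  "intersection_numbers G p \<longleftrightarrow>
    (\<forall>h \<le> graph_diameter G. \<forall>i \<le> graph_diameter G. \<forall>j \<le> graph_diameter G.
      \<forall>u \<in> pverts G. \<forall>v \<in> pverts G. graph_dist G u v = h \<longrightarrow>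
        card {w \<in> pverts G. graph_dist G u w = i \<and> graph_dist G v w = j} = p h i j)"

definition distance_regular :: "'a pair_pre_digraph \<Rightarrow> bool" where
  "distance_regular G \<longleftrightarrow>
    pair_graph G \<and> connected (with_proj G) \<and> (\<exists>p. intersection_numbers G p)"

text \<open>
  The array $\{b_0,\dots,b_{d-1};c_1,\dots,c_d\}$ is given by two lists of length \<open>d\<close>; since lists
  are indexed from 0, \<open>cs ! i\<close> is $c_{i+1}$.
\<close>

definition has_intersection_array :: "'a pair_pre_digraph \<Rightarrow> nat list \<Rightarrow> nat list \<Rightarrow> bool" where
  "has_intersection_array G bs cs \<longleftrightarrow>
    length bs = graph_diameter G \<and> length cs = graph_diameter G \<and>
    (\<exists>p. intersection_numbers G p \<and>
      (\<forall>i < graph_diameter G. bs ! i = p i 1 (i + 1) \<and> cs ! i = p (i + 1) 1 i))"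

end

(*
  The Krein parameter q^1_22 of the array vanishes, for the ordering 234, 54, 14, -6 of the
  eigenvalues. So the entrywise products of the matching idempotents satisfy
  sum_x E_1(u,x) E_2(v,x) E_2(w,x) = 0 for all vertices u, v, w, because the sum of the squares of
  the left-hand sides is a multiple of q^1_22. Since p^3_33 = 8 > 0, there are three vertices
  pairwise at distance 3; for them these equations contradict the nonnegativity of the triple
  intersection numbers.
*)

theory Submission
  imports Defs
begin

section \<open>Sums of squares of triple products\<close>

text \<open>Expanding the square gives a double sum over \<open>x\<close> and \<open>y\<close>; for
  fixed \<open>x\<close> and \<open>y\<close> the sum over \<open>(u, v, w)\<close> factors. When
  the matrices are multiples of symmetric projections, each factor is a multiple of a matrix
  entry.\<close>

lemma sum_square_triple_product:
  fixes a b c :: "'a \<Rightarrow> 'b \<Rightarrow> int"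
  assumes "finite U" "finite V"
  shows "(\<Sum>(u, v, w)\<in>U \<times> U \<times> U. (\<Sum>x\<in>V. a u x * b v x * c w x)\<^sup>2) =
    (\<Sum>x\<in>V. \<Sum>y\<in>V. (\<Sum>u\<in>U. a u x * a u y) * (\<Sum>v\<in>U. b v x * b v y) * (\<Sum>w\<in>U. c w x * c w y))"
proof -
  have "(\<Sum>(u, v, w)\<in>U \<times> U \<times> U. (\<Sum>x\<in>V. a u x * b v x * c w x)\<^sup>2) =
      (\<Sum>(u, v, w)\<in>U \<times> U \<times> U. \<Sum>x\<in>V. \<Sum>y\<in>V. (a u x * b v x * c w x) * (a u y * b v y * c w y))"
    by (simp add: power2_eq_square sum_product)
  also have "\<dots> = (\<Sum>x\<in>V. \<Sum>(u, v, w)\<in>U \<times> U \<times> U. \<Sum>y\<in>V. (a u x * b v x * c w x) * (a u y * b v y * c w y))"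
    by (simp add: case_prod_unfold, rule sum.swap)
  also have "\<dots> = (\<Sum>x\<in>V. \<Sum>y\<in>V. \<Sum>(u, v, w)\<in>U \<times> U \<times> U. (a u x * b v x * c w x) * (a u y * b v y * c w y))"
    by (intro sum.cong refl, simp add: case_prod_unfold, rule sum.swap)
  also have "\<dots> = (\<Sum>x\<in>V. \<Sum>y\<in>V. (\<Sum>u\<in>U. a u x * a u y) * (\<Sum>v\<in>U. b v x * b v y) * (\<Sum>w\<in>U. c w x * c w y))"
  proof (intro sum.cong refl)
    fix x y
    have "(\<Sum>(u, v, w)\<in>U \<times> U \<times> U. (a u x * b v x * c w x) * (a u y * b v y * c w y)) =
        (\<Sum>u\<in>U. \<Sum>v\<in>U. \<Sum>w\<in>U. (a u x * a u y) * ((b v x * b v y) * (c w x * c w y)))"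
      by (simp add: sum.cartesian_product mult_ac)
    also have "\<dots> = (\<Sum>u\<in>U. a u x * a u y) * ((\<Sum>v\<in>U. b v x * b v y) * (\<Sum>w\<in>U. c w x * c w y))"
      by (simp only: sum_distrib_right) (simp only: sum_distrib_left)
    finally show "(\<Sum>(u, v, w)\<in>U \<times> U \<times> U. (a u x * b v x * c w x) * (a u y * b v y * c w y)) =
        (\<Sum>u\<in>U. a u x * a u y) * (\<Sum>v\<in>U. b v x * b v y) * (\<Sum>w\<in>U. c w x * c w y)"
      by (simp only: mult.assoc)
  qed
  finally show ?thesis .
qed

section \<open>Counting in distance-regular metrics\<close>

locale regular_metric =
  fixes V :: "'a set" and d :: "'a \<Rightarrow> 'a \<Rightarrow> nat" and D :: nat and p :: "nat \<Rightarrow> nat \<Rightarrow> nat \<Rightarrow> nat"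
  assumes finite_V: "finite V"
    and dist_sym: "\<lbrakk>u \<in> V; v \<in> V\<rbrakk> \<Longrightarrow> d u v = d v u"
    and dist_eq_0: "\<lbrakk>u \<in> V; v \<in> V\<rbrakk> \<Longrightarrow> d u v = 0 \<longleftrightarrow> u = v"
    and dist_triangle: "\<lbrakk>u \<in> V; v \<in> V; w \<in> V\<rbrakk> \<Longrightarrow> d u w \<le> d u v + d v w"
    and dist_le: "\<lbrakk>u \<in> V; v \<in> V\<rbrakk> \<Longrightarrow> d u v \<le> D"
    and card_eq: "\<lbrakk>u \<in> V; v \<in> V; i \<le> D; j \<le> D\<rbrakk> \<Longrightarrow>
      card {w \<in> V. d u w = i \<and> d v w = j} = p (d u v) i j"
begin

text \<open>Grouping the vertices \<open>w\<close> by the pair \<open>(d u w, d v w)\<close> gives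
  classes of size \<open>p (d u v) i j\<close>.\<close>

lemma sum_dist_pair:
  fixes f :: "nat \<Rightarrow> nat \<Rightarrow> int"
  assumes "u \<in> V" "v \<in> V"
  shows "(\<Sum>w\<in>V. f (d u w) (d v w)) = (\<Sum>i\<le>D. \<Sum>j\<le>D. f i j * int (p (d u v) i j))"
proof -
  have "(\<Sum>w\<in>V. f (d u w) (d v w)) =
      (\<Sum>w\<in>V. \<Sum>i\<le>D. \<Sum>j\<le>D. if d u w = i \<and> d v w = j then f i j else 0)"
  proof (intro sum.cong refl)
    fix w assume w: "w \<in> V"
    have "(\<Sum>i\<le>D. \<Sum>j\<le>D. if d u w = i \<and> d v w = j then f i j else 0) =
        (\<Sum>i\<le>D. if d u w = i then \<Sum>j\<le>D. if d v w = j then f i j else 0 else 0)"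
      by (intro sum.cong refl) auto
    then show "f (d u w) (d v w) = (\<Sum>i\<le>D. \<Sum>j\<le>D. if d u w = i \<and> d v w = j then f i j else 0)"
      using assms w dist_le by simp
  qed
  also have "\<dots> = (\<Sum>i\<le>D. \<Sum>w\<in>V. \<Sum>j\<le>D. if d u w = i \<and> d v w = j then f i j else 0)"
    by (rule sum.swap)
  also have "\<dots> = (\<Sum>i\<le>D. \<Sum>j\<le>D. \<Sum>w\<in>V. if d u w = i \<and> d v w = j then f i j else 0)"
    by (intro sum.cong refl sum.swap)
  also have "\<dots> = (\<Sum>i\<le>D. \<Sum>j\<le>D. f i j * int (p (d u v) i j))"
  proof (intro sum.cong refl)
    fix i j assume "i \<in> {..D}" "j \<in> {..D}"
    then have "p (d u v) i j = card {w \<in> V. d u w = i \<and> d v w = j}"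
      using assms card_eq by simp
    moreover have "(\<Sum>w\<in>V. if d u w = i \<and> d v w = j then f i j else 0) =
        (\<Sum>w\<in>{w \<in> V. d u w = i \<and> d v w = j}. f i j)"
      using finite_V by (simp flip: sum.inter_filter)
    ultimately show "(\<Sum>w\<in>V. if d u w = i \<and> d v w = j then f i j else 0) = f i j * int (p (d u v) i j)"
      by simp
  qed
  finally show ?thesis .
qed

lemma intersection_commute:
  assumes "u \<in> V" "v \<in> V" "i \<le> D" "j \<le> D"
  shows "p (d u v) i j = p (d u v) j i"
proof -
  have "p (d u v) i j = card {w \<in> V. d u w = i \<and> d v w = j}"
    using assms card_eq by simp
  also have "\<dots> = card {w \<in> V. d v w = j \<and> d u w = i}"
    by (simp add: conj_commute)
  also have "\<dots> = p (d u v) j i"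
    using assms card_eq[of v u j i] dist_sym by simp
  finally show ?thesis .
qed

lemma intersection_eq_0:
  assumes "u \<in> V" "v \<in> V" "i \<le> D" "j \<le> D" "i + j < d u v \<or> d u v + i < j \<or> d u v + j < i"
  shows "p (d u v) i j = 0"
proof -
  have "{w \<in> V. d u w = i \<and> d v w = j} = {}"
  proof -
    have False if w: "w \<in> V" "d u w = i" "d v w = j" for w
      using assms w dist_triangle[of u w v] dist_triangle[of v u w] dist_triangle[of u v w]
        dist_sym[of v w] dist_sym[of u v] by linarith
    then show ?thesis by blast
  qed
  then show ?thesis
    using card_eq[of u v i j] assms(1-4) by (metis card.empty)
qed

lemma intersection_0:
  assumes "u \<in> V" "v \<in> V" "j \<le> D"
  shows "p (d u v) 0 j = (if j = d u v then 1 else 0)"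
proof -
  have "{w \<in> V. d u w = 0 \<and> d v w = j} = (if j = d u v then {u} else {})"
    using assms dist_eq_0 dist_sym by auto
  then show ?thesis
    using card_eq[of u v 0 j] assms by (simp split: if_splits)
qed

lemma sum_intersection:
  assumes "u \<in> V" "v \<in> V" "i \<le> D"
  shows "(\<Sum>j\<le>D. p (d u v) i j) = p 0 i i"
proof -
  have "int (\<Sum>j\<le>D. p (d u v) i j) = (\<Sum>k\<le>D. \<Sum>j\<le>D. of_bool (k = i) * int (p (d u v) k j))"
    using assms by (simp flip: sum_distrib_left)
  also have "\<dots> = (\<Sum>w\<in>V. of_bool (d u w = i))"
    using sum_dist_pair[OF assms(1,2), of "\<lambda>k j. of_bool (k = i)"] by simp
  also have "\<dots> = int (card {w \<in> V. d u w = i \<and> d u w = i})"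
    using finite_V by (simp add: of_bool_def flip: sum.inter_filter)
  also have "\<dots> = int (p 0 i i)"
    using card_eq[of u u i i] assms dist_eq_0[of u u] by simp
  finally show ?thesis by (simp only: of_nat_eq_iff)
qed

text \<open>Both sides count the pairs \<open>(w, z)\<close> with \<open>d u w = i\<close>,
  \<open>d z w = k\<close> and \<open>d v z = j\<close>: the left chooses \<open>z\<close> first,
  the right \<open>w\<close>. The case \<open>k = 1\<close> is the recurrence that recovers all
  intersection numbers from the array.\<close>

lemma intersection_assoc:
  assumes "u \<in> V" "v \<in> V" "i \<le> D" "j \<le> D" "k \<le> D"
  shows "(\<Sum>l\<le>D. p l i k * p (d u v) l j) = (\<Sum>l\<le>D. p l j k * p (d u v) i l)"
proof -
  have card: "int (p (d x z) a b) = (\<Sum>w\<in>V. of_bool (d x w = a) * of_bool (d z w = b))"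
    if "x \<in> V" "z \<in> V" "a \<le> D" "b \<le> D" for x z a b
  proof -
    have "(\<Sum>w\<in>V. of_bool (d x w = a) * of_bool (d z w = b)) =
        (\<Sum>w\<in>V. if d x w = a \<and> d z w = b then 1 else (0 :: int))"
      by (intro sum.cong refl) simp
    also have "\<dots> = int (card {w \<in> V. d x w = a \<and> d z w = b})"
      using finite_V by (simp flip: sum.inter_filter)
    finally have "(\<Sum>w\<in>V. of_bool (d x w = a) * of_bool (d z w = b)) =
        int (card {w \<in> V. d x w = a \<and> d z w = b})" .
    then show ?thesis using card_eq that by simp
  qed
  have "int (\<Sum>l\<le>D. p l i k * p (d u v) l j) =
      (\<Sum>l\<le>D. \<Sum>m\<le>D. int (p l i k) * of_bool (m = j) * int (p (d u v) l m))"
    using assms by (simp add: if_distrib if_distribR of_bool_def cong: if_cong)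
  also have "\<dots> = (\<Sum>z\<in>V. int (p (d u z) i k) * of_bool (d v z = j))"
    using sum_dist_pair[OF assms(1,2), of "\<lambda>l m. int (p l i k) * of_bool (m = j)"] by simp
  also have "\<dots> = (\<Sum>z\<in>V. \<Sum>w\<in>V. of_bool (d u w = i) * of_bool (d z w = k) * of_bool (d v z = j))"
    using assms by (simp add: card sum_distrib_right)
  also have "\<dots> = (\<Sum>w\<in>V. \<Sum>z\<in>V. of_bool (d u w = i) * of_bool (d z w = k) * of_bool (d v z = j))"
    by (rule sum.swap)
  also have "\<dots> = (\<Sum>w\<in>V. of_bool (d u w = i) * int (p (d v w) j k))"
  proof (intro sum.cong refl)
    fix w assume "w \<in> V"
    then show "(\<Sum>z\<in>V. of_bool (d u w = i) * of_bool (d z w = k) * of_bool (d v z = j)) =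
        of_bool (d u w = i) * int (p (d v w) j k)"
      using assms card[of v w j k]
      by (simp add: sum_distrib_left) (intro impI sum.cong refl, simp add: dist_sym[of _ w] mult.commute)
  qed
  also have "\<dots> = (\<Sum>m\<le>D. \<Sum>l\<le>D. of_bool (m = i) * int (p l j k) * int (p (d u v) m l))"
    using sum_dist_pair[OF assms(1,2), of "\<lambda>m l. of_bool (m = i) * int (p l j k)"] by simp
  also have "\<dots> = (\<Sum>m\<le>D. of_bool (m = i) * (\<Sum>l\<le>D. int (p l j k) * int (p (d u v) m l)))"
    by (simp add: sum_distrib_left mult_ac)
  also have "\<dots> = int (\<Sum>l\<le>D. p l j k * p (d u v) i l)"
    using assms by simp
  finally show ?thesis by (simp only: of_nat_eq_iff)
qed

text \<open>The hypotheses on \<open>q\<^sub>1, q\<^sub>2, q\<^sub>3\<close> say that the matrices \<open>q\<^sub>i (d x y)\<close> are multiples of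
  projections, and that the corresponding Krein parameter vanishes.\<close>

lemma krein_triple_sum_eq_0:
  fixes q1 q2 q3 :: "nat \<Rightarrow> int"
  assumes proj: "\<And>q h. \<lbrakk>q \<in> {q1, q2, q3}; h \<le> D\<rbrakk> \<Longrightarrow>
      (\<Sum>i\<le>D. \<Sum>j\<le>D. q i * q j * int (p h i j)) = c * q h"
    and krein: "(\<Sum>i\<le>D. \<Sum>j\<le>D. q1 i * q2 i * q3 i * int (p 0 i j)) = 0"
    and V: "u \<in> V" "v \<in> V" "w \<in> V"
  shows "(\<Sum>x\<in>V. q1 (d u x) * q2 (d v x) * q3 (d w x)) = 0"
proof -
  let ?f = "\<lambda>u v w. \<Sum>x\<in>V. q1 (d u x) * q2 (d v x) * q3 (d w x)"
  have proj_sum: "(\<Sum>u\<in>V. q (d u x) * q (d u y)) = c * q (d x y)"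
    if "q \<in> {q1, q2, q3}" "x \<in> V" "y \<in> V" for q x y
  proof -
    have "(\<Sum>u\<in>V. q (d u x) * q (d u y)) = (\<Sum>u\<in>V. q (d x u) * q (d y u))"
      using that(2,3) dist_sym by (intro sum.cong) auto
    then show ?thesis
      using sum_dist_pair[OF that(2,3), of "\<lambda>i j. q i * q j"] proj[OF that(1) dist_le[OF that(2,3)]]
      by simp
  qed
  have "(\<Sum>(u, v, w)\<in>V \<times> V \<times> V. (?f u v w)\<^sup>2) =
      (\<Sum>x\<in>V. \<Sum>y\<in>V. c * q1 (d x y) * (c * q2 (d x y)) * (c * q3 (d x y)))"
    using sum_square_triple_product[OF finite_V finite_V, of "\<lambda>u x. q1 (d u x)" "\<lambda>u x. q2 (d u x)" "\<lambda>u x. q3 (d u x)"]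
    by (simp add: proj_sum)
  also have "\<dots> = c ^ 3 * (\<Sum>x\<in>V. \<Sum>y\<in>V. q1 (d x y) * q2 (d x y) * q3 (d x y))"
    by (simp add: sum_distrib_left power3_eq_cube mult_ac)
  also have "\<dots> = 0"
  proof -
    \<comment> \<open>With both base vertices equal to \<open>x\<close> the distance is 0, so this
      is the Krein sum of the hypothesis.\<close>
    have "(\<Sum>y\<in>V. q1 (d x y) * q2 (d x y) * q3 (d x y)) = 0" if "x \<in> V" for x
      using sum_dist_pair[OF that that, of "\<lambda>i j. q1 i * q2 i * q3 i"] krein dist_eq_0[OF that that]
      by simp
    then show ?thesis by simp
  qed
  \<comment> \<open>A vanishing sum of squares has only zero terms.\<close>
  finally have "\<forall>t\<in>V \<times> V \<times> V. (case t of (u, v, w) \<Rightarrow> (?f u v w)\<^sup>2) = 0"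
    using finite_V by (subst (asm) sum_nonneg_eq_0_iff) auto
  then show ?thesis using V by auto
qed

text \<open>From a pair \<open>u\<close>, \<open>v\<close> at distance \<open>h\<close>, a positive
  $b_h$ yields a neighbour \<open>w\<close> of \<open>u\<close> at distance \<open>h + 1\<close>
  from \<open>v\<close>. Identities proved for \<open>p (d u v)\<close> thereby hold for every
  \<open>p h\<close>.\<close>

lemma exists_dist:
  assumes "V \<noteq> {}" and array: "p 0 1 1 > 0" "\<And>i. \<lbrakk>0 < i; i < D\<rbrakk> \<Longrightarrow> p i 1 (i + 1) > 0" and "h \<le> D"
  shows "\<exists>u\<in>V. \<exists>v\<in>V. d u v = h"
  using \<open>h \<le> D\<close>
proof (induction h)
  case 0
  then show ?case using \<open>V \<noteq> {}\<close> dist_eq_0 by blast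
next
  case (Suc h)
  then obtain u v where uv: "u \<in> V" "v \<in> V" "d u v = h" by auto
  have "p h 1 (h + 1) > 0"
    using array(1) array(2)[of h] Suc.prems by (cases h) auto
  then have "card {w \<in> V. d u w = 1 \<and> d v w = h + 1} > 0"
    using card_eq[of u v 1 "h + 1"] uv Suc.prems by simp
  then obtain w where "w \<in> V" "d v w = h + 1"
    by (metis (mono_tags, lifting) card_gt_0_iff empty_Collect_eq)
  then show ?case using uv(2) by auto
qed

end

section \<open>Numerical data of the array\<close>

lemma sum_atMost_3: "(\<Sum>i\<le>3. f i) = f 0 + f 1 + f 2 + f (3 :: nat)"
  for f :: "nat \<Rightarrow> 'a :: comm_monoid_add"
  by (simp add: numeral_3_eq_3 numeral_2_eq_2)

lemma le_3_cases: "(n :: nat) \<le> 3 \<longleftrightarrow> n = 0 \<or> n = 1 \<or> n = 2 \<or> n = 3"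
  by auto

text \<open>All $p^h_{ij}$ forced by the array; \<open>h\<close> selects the matrix. The diagonal of
  the first one lists the valencies, with sum 1600.\<close>

definition intersection_table :: "nat \<Rightarrow> nat \<Rightarrow> nat \<Rightarrow> nat" where
  "intersection_table h i j =
    [[[1, 0, 0, 0], [0, 234, 0, 0], [0, 0, 1287, 0], [0, 0, 0, 78]],
     [[0, 1, 0, 0], [1, 68, 165, 0], [0, 165, 1056, 66], [0, 0, 66, 12]],
     [[0, 0, 1, 0], [0, 30, 192, 12], [1, 192, 1030, 64], [0, 12, 64, 2]],
     [[0, 0, 0, 1], [0, 0, 198, 36], [0, 198, 1056, 33], [1, 36, 33, 8]]] ! h ! i ! j"

text \<open>The columns of the second eigenmatrix that belong to the eigenvalues 54 and 14.\<close>

definition q1 :: "nat \<Rightarrow> int" where "q1 i = [78, 18, -2, -22] ! i"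
definition q2 :: "nat \<Rightarrow> int" where "q2 i = [234, 14, -6, 54] ! i"

text \<open>
  If \<open>u, v, w\<close> are pairwise at distance 3 and \<open>N\<^sub>r\<^sub>s\<^sub>t\<close> counts the vertices at distances \<open>r, s, t\<close>
  from them, then the Krein condition and the linear relations between the \<open>N\<^sub>r\<^sub>s\<^sub>t\<close> and the
  intersection numbers force \<open>N\<^sub>2\<^sub>3\<^sub>3 = - 17 - 4 N\<^sub>3\<^sub>3\<^sub>3\<close>. The weights are the multipliers of these
  linear relations: with them \<open>weight_ge\<close> is an equality at every feasible triple except
  \<open>(3, 3, 3)\<close> and the permutations of \<open>(2, 3, 3)\<close>. Entries at infeasible pairs are irrelevant.
\<close>

definition weight :: "nat \<Rightarrow> nat \<Rightarrow> int" where
  "weight i j = [[0, 0, 0, -180192], [0, 0, 528, -6312], [0, 528, -72, 288], [-180192, -6312, 288, 31848]] ! i ! j"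

text \<open>The constant 1600 is the number of vertices: the idempotents have entries
  \<open>q (d x y) / 1600\<close>.\<close>

lemma q_idempotent:
  assumes "q \<in> {q1, q2}" "h \<le> 3"
  shows "(\<Sum>i\<le>3. \<Sum>j\<le>3. q i * q j * int (intersection_table h i j)) = 1600 * q h"
  using assms unfolding le_3_cases sum_atMost_3
  by (elim insertE emptyE disjE; hypsubst; simp add: intersection_table_def q1_def q2_def)

lemma krein_parameter_eq_0:
  "(\<Sum>i\<le>3. \<Sum>j\<le>3. q1 i * q2 i * q2 i * int (intersection_table 0 i j)) = 0"
  by (simp add: sum_atMost_3 intersection_table_def q1_def q2_def)

text \<open>The table obeys the same recurrence as \<open>p\<close>, so comparing the two isolates
  one unknown entry at a time.\<close>

lemma intersection_table_assoc:
  assumes "h \<le> 3" "i \<le> 3" "j \<le> 3"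
  shows "(\<Sum>l\<le>3. intersection_table l i 1 * intersection_table h l j) =
    (\<Sum>l\<le>3. intersection_table l j 1 * intersection_table h i l)"
  using assms unfolding le_3_cases sum_atMost_3
  by (elim disjE; hypsubst; simp add: intersection_table_def)

text \<open>The left-hand side is symmetrized over the vertex that carries \<open>q1\<close>, so one
  weight matrix serves all three pairs. The slack is 288000 at \<open>(3, 3, 3)\<close> and 24000 at
  the permutations of \<open>(2, 3, 3)\<close>.\<close>

lemma weight_ge:
  assumes "r \<le> 3" "s \<le> 3" "t \<le> 3"
    and "intersection_table 3 r s \<noteq> 0" "intersection_table 3 r t \<noteq> 0" "intersection_table 3 s t \<noteq> 0"
  shows "q1 r * q2 s * q2 t + q1 s * q2 r * q2 t + q1 t * q2 r * q2 s \<le> weight r s + weight r t + weight s t"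
  using assms unfolding le_3_cases
  by (elim disjE; hypsubst; simp add: intersection_table_def q1_def q2_def weight_def)

text \<open>The sum is -408000. Three pairs give -1224000, which no nonnegative combination of the
  slacks can equal.\<close>

lemma weight_sum_neg: "(\<Sum>i\<le>3. \<Sum>j\<le>3. weight i j * int (intersection_table 3 i j)) < 0"
  by (simp add: sum_atMost_3 intersection_table_def weight_def)

section \<open>Metrics with the given array\<close>

locale array_metric = regular_metric V d 3 p for V :: "'a set" and d p +
  assumes nonempty: "V \<noteq> {}"
    and array: "p 0 1 1 = 234" "p 1 1 2 = 165" "p 2 1 3 = 12" "p 1 1 0 = 1" "p 2 1 1 = 30" "p 3 1 2 = 198"
begin

lemma obtain_dist:
  assumes "h \<le> 3"
  obtains u v where "u \<in> V" "v \<in> V" "d u v = h"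
proof -
  have "p i 1 (i + 1) > 0" if "0 < i" "i < 3" for i
  proof -
    have "i = 1 \<or> i = 2" using that by auto
    then show ?thesis using array by (auto simp: numeral_2_eq_2 numeral_3_eq_3)
  qed
  then show ?thesis using exists_dist[of h] assms nonempty array that by auto
qed

lemma p_eq_table:
  assumes "h \<le> 3" "i \<le> 3" "j \<le> 3"
  shows "p h i j = intersection_table h i j"
proof -
  have p0: "p h 0 j = (if j = h then 1 else 0)" if "h \<le> 3" "j \<le> 3" for h j
    using obtain_dist[OF \<open>h \<le> 3\<close>] intersection_0 that by metis
  have p0': "p h 0 j = intersection_table h 0 j" if "h \<le> 3" "j \<le> 3" for h j
    using that p0[of h j] by (auto simp: le_3_cases intersection_table_def)
  have sym: "p h i j = p h j i" if "h \<le> 3" "i \<le> 3" "j \<le> 3" for h i j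
    using obtain_dist[OF \<open>h \<le> 3\<close>] intersection_commute that by metis
  have zero: "p h i j = 0" if "h \<le> 3" "i \<le> 3" "j \<le> 3" "i + j < h \<or> h + i < j \<or> h + j < i" for h i j
    using obtain_dist[OF \<open>h \<le> 3\<close>] intersection_eq_0 that by metis
  have sum1: "(\<Sum>j\<le>3. p h 1 j) = 234" if "h \<le> 3" for h
    using obtain_dist[OF \<open>h \<le> 3\<close>] sum_intersection[where i = 1] array(1) by auto
  have assoc: "(\<Sum>l\<le>3. p l i 1 * p h l j) = (\<Sum>l\<le>3. p l j 1 * p h i l)"
    if "h \<le> 3" "i \<le> 3" "j \<le> 3" for h i j
    using obtain_dist[OF \<open>h \<le> 3\<close>] intersection_assoc[of _ _ i j 1] that by fastforce
  \<comment> \<open>For \<open>h > 0\<close> the array supplies $b_h$ and $c_h$;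
    \<open>p h 1 h\<close> is what remains of the row sum 234.\<close>
  have p1: "p h 1 j = intersection_table h 1 j" if "h \<le> 3" "j \<le> 3" for h j
    using that sum1[of h] array zero[of h 1 j] p0[of 0 1] zero[of 0 1 2] zero[of 0 1 3] sym[of 0 1 0]
      zero[of 1 1 3] zero[of 2 1 0] zero[of 3 1 0] zero[of 3 1 1]
    by (auto simp: le_3_cases intersection_table_def sum_atMost_3)
  have p1': "p h j 1 = intersection_table h j 1" if "h \<le> 3" "j \<le> 3" for h j
  proof -
    have "intersection_table h 1 j = intersection_table h j 1"
      using that by (auto simp: le_3_cases intersection_table_def)
    then show ?thesis using p1 sym[of h j 1] that by simp
  qed
  have p2: "p h 2 j = intersection_table h 2 j" if "h \<le> 3" "j \<le> 3" for h j
  proof -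
    \<comment> \<open>In the recurrence for row 1, the unknown \<open>p h 2 j\<close> has
      coefficient $c_2 = 30$, and \<open>p h 3 j\<close> has coefficient 0.\<close>
    have "intersection_table 2 1 1 = 30" "intersection_table 3 1 1 = 0"
      by (simp_all add: intersection_table_def)
    then show ?thesis
      using assoc[of h 1 j] intersection_table_assoc[of h 1 j] that
      by (simp add: sum_atMost_3 p0' p1 p1' del: One_nat_def)
  qed
  have p3: "p h 3 j = intersection_table h 3 j" if "h \<le> 3" "j \<le> 3" for h j
  proof -
    \<comment> \<open>In the recurrence for row 2, the only unknown \<open>p h 3 j\<close> has
      coefficient $c_3 = 198$.\<close>
    have "intersection_table 3 2 1 = 198"
      by (simp add: intersection_table_def)
    then show ?thesis
      using assoc[of h 2 j] intersection_table_assoc[of h 2 j] that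
      by (simp add: sum_atMost_3 p0' p1 p1' p2 del: One_nat_def)
  qed
  show ?thesis
    using assms p0'[of h j] p1[of h j] p2[of h j] p3[of h j] by (auto simp: le_3_cases[of i])
qed

lemma triple_sum_eq_0:
  assumes "u \<in> V" "v \<in> V" "w \<in> V"
  shows "(\<Sum>x\<in>V. q1 (d u x) * q2 (d v x) * q2 (d w x)) = 0"
proof (rule krein_triple_sum_eq_0[where c = 1600, OF _ _ assms])
  show "(\<Sum>i\<le>3. \<Sum>j\<le>3. q i * q j * int (p h i j)) = 1600 * q h" if "q \<in> {q1, q2, q2}" "h \<le> 3" for q h
    using q_idempotent[of q h] that by (simp add: p_eq_table)
  show "(\<Sum>i\<le>3. \<Sum>j\<le>3. q1 i * q2 i * q2 i * int (p 0 i j)) = 0"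
    using krein_parameter_eq_0 by (simp add: p_eq_table)
qed

lemma array_contradiction: False
proof -
  obtain u v where uv: "u \<in> V" "v \<in> V" "d u v = 3"
    using obtain_dist[of 3] by auto
  have "card {w \<in> V. d u w = 3 \<and> d v w = 3} = 8"
    using card_eq[of u v 3 3] uv by (simp add: p_eq_table intersection_table_def)
  then have "{w \<in> V. d u w = 3 \<and> d v w = 3} \<noteq> {}"
    by (metis card.empty zero_neq_numeral)
  then obtain w where w: "w \<in> V" "d u w = 3" "d v w = 3" by auto
  \<comment> \<open>The vertex \<open>z\<close> itself is counted, so every triple of distances that
    occurs is feasible in \<open>weight_ge\<close>.\<close>
  have p_nonzero: "p (d x y) (d x z) (d y z) \<noteq> 0" if "x \<in> V" "y \<in> V" "z \<in> V" for x y z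
  proof -
    have "card {z' \<in> V. d x z' = d x z \<and> d y z' = d y z} \<noteq> 0"
      using that finite_V by auto
    then show ?thesis using card_eq[of x y] that dist_le by simp
  qed
  have weight_sum: "(\<Sum>x\<in>V. weight (d y x) (d z x)) = (\<Sum>i\<le>3. \<Sum>j\<le>3. weight i j * int (p 3 i j))"
    if "y \<in> V" "z \<in> V" "d y z = 3" for y z
    using sum_dist_pair[of y z weight] that by simp
  have "0 = (\<Sum>x\<in>V. q1 (d u x) * q2 (d v x) * q2 (d w x)) + (\<Sum>x\<in>V. q1 (d v x) * q2 (d u x) * q2 (d w x))
      + (\<Sum>x\<in>V. q1 (d w x) * q2 (d u x) * q2 (d v x))"
    using uv w by (simp add: triple_sum_eq_0)
  also have "\<dots> = (\<Sum>x\<in>V. q1 (d u x) * q2 (d v x) * q2 (d w x) + q1 (d v x) * q2 (d u x) * q2 (d w x)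
      + q1 (d w x) * q2 (d u x) * q2 (d v x))"
    by (simp add: sum.distrib)
  also have "\<dots> \<le> (\<Sum>x\<in>V. weight (d u x) (d v x) + weight (d u x) (d w x) + weight (d v x) (d w x))"
  proof (rule sum_mono)
    fix x assume "x \<in> V"
    then show "q1 (d u x) * q2 (d v x) * q2 (d w x) + q1 (d v x) * q2 (d u x) * q2 (d w x)
        + q1 (d w x) * q2 (d u x) * q2 (d v x) \<le> weight (d u x) (d v x) + weight (d u x) (d w x) + weight (d v x) (d w x)"
      using weight_ge[of "d u x" "d v x" "d w x"] p_nonzero[of u v x] p_nonzero[of u w x] p_nonzero[of v w x]
        uv w dist_le by (simp add: p_eq_table)
  qed
  \<comment> \<open>Each pair among \<open>u\<close>, \<open>v\<close>, \<open>w\<close> is at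
    distance 3 and contributes the same weight sum.\<close>
  also have "\<dots> = 3 * (\<Sum>i\<le>3. \<Sum>j\<le>3. weight i j * int (p 3 i j))"
    using uv w by (simp add: sum.distrib weight_sum)
  also have "\<dots> < 0"
    using weight_sum_neg by (simp add: p_eq_table)
  finally show False by simp
qed

end

section \<open>The graph distance as a regular metric\<close>

text \<open>Connectedness refers to the symmetric closure, but the arcs are already symmetric. So a
  walk exists and the \<open>LEAST\<close> in \<open>graph_dist\<close> is attained.\<close>

lemma (in pair_graph) exists_shortest_awalk:
  assumes "connected (with_proj G)" "u \<in> pverts G" "v \<in> pverts G"
  obtains p where "awalk u p v" "length p = graph_dist G u v"
proof -
  have "u \<rightarrow>\<^sup>*\<^bsub>mk_symmetric (with_proj G)\<^esub> v"
    using assms by (auto simp: connected_def)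
  then have "u \<rightarrow>\<^sup>*\<^bsub>with_proj G\<^esub> v"
    using reachable_mk_symmetric_eq sym_arcs by blast
  then have "\<exists>n p. awalk u p v \<and> length p = n"
    by (simp add: reachable_awalk)
  then show ?thesis
    using that LeastI_ex[of "\<lambda>n. \<exists>p. awalk u p v \<and> length p = n"] unfolding graph_dist_def by blast
qed

lemma (in pair_graph) graph_dist_le_length:
  assumes "awalk u p v"
  shows "graph_dist G u v \<le> length p"
  unfolding graph_dist_def using assms by (auto intro: Least_le)

lemma (in pair_graph) regular_metric_graph_dist:
  assumes conn: "connected (with_proj G)" and p: "intersection_numbers G p"
  shows "regular_metric (pverts G) (graph_dist G) (graph_diameter G) p"
proof -
  \<comment> \<open>Reversing a shortest walk gives one inequality; exchanging \<open>u\<close> and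
    \<open>v\<close> gives the other.\<close>
  have le_sym: "graph_dist G u v \<le> graph_dist G v u" if uv: "u \<in> pverts G" "v \<in> pverts G" for u v
  proof -
    obtain p where "awalk v p u" "length p = graph_dist G v u"
      using exists_shortest_awalk[OF conn] uv by blast
    moreover have "length (rev_path p) = length p" by (induction p) auto
    ultimately show ?thesis using graph_dist_le_length[of u "rev_path p" v] by simp
  qed
  have diam: "graph_dist G u v \<le> graph_diameter G" if uv: "u \<in> pverts G" "v \<in> pverts G" for u v
    unfolding graph_diameter_def
  proof (rule Max_ge)
    have "{graph_dist G u v |u v. u \<in> pverts G \<and> v \<in> pverts G} =
        (\<lambda>(u, v). graph_dist G u v) ` (pverts G \<times> pverts G)" by auto
    then show "finite {graph_dist G u v |u v. u \<in> pverts G \<and> v \<in> pverts G}"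
      using pair_finite_verts by simp
  qed (use uv in auto)
  show ?thesis
  proof
    fix u v w assume uv: "u \<in> pverts G" "v \<in> pverts G"
    show "graph_dist G u v = graph_dist G v u" using le_sym uv by (simp add: antisym)
    show "graph_dist G u v = 0 \<longleftrightarrow> u = v"
    proof
      assume "graph_dist G u v = 0"
      then show "u = v" using exists_shortest_awalk[OF conn uv] by (auto simp: awalk_Nil_iff)
    next
      assume "u = v"
      then show "graph_dist G u v = 0"
        using graph_dist_le_length[of u "[]" v] uv by (simp add: awalk_Nil_iff)
    qed
    show "graph_dist G u v \<le> graph_diameter G" using diam uv .
    show "graph_dist G u w \<le> graph_dist G u v + graph_dist G v w" if w: "w \<in> pverts G"
    proof -
      obtain p where "awalk u p v" "length p = graph_dist G u v"
        using exists_shortest_awalk[OF conn uv] .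
      moreover obtain q where "awalk v q w" "length q = graph_dist G v w"
        using exists_shortest_awalk[OF conn uv(2) w] .
      ultimately show ?thesis
        using graph_dist_le_length[of u "p @ q" w] awalk_appendI by fastforce
    qed
    show "card {w \<in> pverts G. graph_dist G u w = i \<and> graph_dist G v w = j} = p (graph_dist G u v) i j"
      if "i \<le> graph_diameter G" "j \<le> graph_diameter G" for i j
      using p uv that diam unfolding intersection_numbers_def by blast
  qed (rule pair_finite_verts)
qed

theorem theorem5:
  shows "\<not> (\<exists>G :: 'a pair_pre_digraph.
    distance_regular G \<and> has_intersection_array G [234, 165, 12] [1, 30, 198])"
proof
  assume "\<exists>G :: 'a pair_pre_digraph.
    distance_regular G \<and> has_intersection_array G [234, 165, 12] [1, 30, 198]"
  then obtain G :: "'a pair_pre_digraph" and p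
    where G: "pair_graph G" "connected (with_proj G)"
      and p: "intersection_numbers G p" and diam: "graph_diameter G = 3"
      and array: "\<And>i. i < 3 \<Longrightarrow> [234, 165, 12] ! i = p i 1 (i + 1) \<and> [1, 30, 198] ! i = p (i + 1) 1 i"
    unfolding distance_regular_def has_intersection_array_def by fastforce
  interpret pair_graph G by (fact G(1))
  interpret regular_metric "pverts G" "graph_dist G" 3 p
    using regular_metric_graph_dist[OF G(2) p] diam by simp
  have "pverts G \<noteq> {}"
    using G(2) by (auto simp: connected_def strongly_connected_def)
  then interpret array_metric "pverts G" "graph_dist G" p
    \<comment> \<open>The instance \<open>i\<close> yields both $b_i$ and $c_{i+1}$.\<close>
    using array[of 0] array[of 1] array[of 2] by unfold_locales (simp_all add: numeral_eq_Suc)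
  show False by (rule array_contradiction)
qed

end
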